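(* Let $(T,M,\mu)$ be a measure space with a non-trivial $\sigma$-finite measure, equipped with a Nikol'skii class $\{A(n)\}$ with function $\sigma=\sigma(n)$ and exponent ranges $(p_-,p_+)$, $(q_-,q_+)$. Let $(X,\|\cdot\|X)$ be a moment rearrangement invariant (m.r.i.) space over $(T,M,\mu)$ with support $\mathrm{supp}(X)=(c,d)$ relative to an auxiliary norm $\langle\cdot\rangle$, and let $(Y,\|\cdot\|Y)$ be another m.r.i. space over the same triple $(T,M,\mu)$ with support $\mathrm{supp}(Y)=(a,b)$ relative to a second auxiliary norm $\langle\langle\cdot\rangle\rangle$, where $(c,d)>>(a,b)$. Suppose that $1\le p_-=a$, $p_+=b$, $q_-=c$, $q_+=d\le\infty$. Then $(X,Y)$ is a (strong) Nikol'skii pair, i.e. $$\sup_n W_n(X,Y)=C(X,Y)<\infty .$$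
   Context: For measurable $f:T\to\mathbb R$, $|f|_p=\left(\int_T|f|^p\,d\mu\right)^{1/p}$ for $p<\infty$, $|f|_\infty=\sup_x|f(x)|$, and $L_p(\mu)=\{f:|f|_p<\infty\}$. Nikol'skii class: let $1\le p_-<p_+<q_-<q_+\le\infty$ and let $\sigma=\sigma(n)$ be an increasing function with $\sigma(n)\ge 3$ and $\sigma(n)\to\infty$. A family $\{A(n)\}$ of linear subspaces of $\bigcap_{p\in(p_-,q_+)}L_p(\mu)$ with $A(n)\subset A(m)$ for $m>n$ is a Nikol'skii class with function $\sigma$ and exponent ranges $(p_-,p_+)$, $(q_-,q_+)$ if there is a finite constant $C$ (independent of $n,p,q,t_n$) such that for all $p\in(p_-,p_+)$, $q\in(q_-,q_+)$, all $n$ and all $t_n\in A(n)$: $|t_n|_q\le C\,\sigma(n)^{1/p-1/q}\,|t_n|_p$. Moment rearrangement invariant (m.r.i.) space: a rearrangement invariant (r.i.) function space $(X,\|\cdot\|X)$ over $(T,M,\mu)$ for which there exist constants $1\le a<b\le\infty$ and a rearrangement invariant norm $\langle\cdot\rangle$ (in particular monotone: $|g|\le|h|$ implies $\langle g\rangle\le\langle h\rangle$) on real functions on the interval $(a,b)$, not necessarily finite on all functions, such that for all $f\in X$: $\|f\|X=\langle h(\cdot)\rangle$ where $h(p)=|f|_p$, $p\in(a,b)$. One writes $\mathrm{supp}(X)=(a,b)$ (the moment support, not necessarily unique). For intervals, $(c,d)>>(a,b)$ means $\min(c,d)>\max(a,b)$. Fundamental function: $\phi(X,\delta)=\sup_{A:\mu(A)\le\delta}\|I(A)\|X$,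 where $I(A)$ is the indicator function of the measurable set $A$. Nikol'skii two-space functional (with $\sigma=\sigma(n)$): $$W_n(X,Y,K_1,K_2)=\sup_{t_n\in A(n),\,t_n\ne0}\left[\frac{\|t_n\|X}{\phi(X,K_1/\sigma)}\Big/\frac{\|t_n\|Y}{\phi(Y,K_2/\sigma)}\right],\qquad W_n(X,Y)=W_n(X,Y,1,1).$$ The pair $(X,Y)$ is a (strong) Nikol'skii pair if $\sup_nW_n(X,Y)<\infty$. *)

theory Defs
  imports "HOL-Analysis.Analysis"
begin

text \<open>
  Every exponent range below is an open interval, so only finite exponents occur; the end points
  themselves may be infinite.
\<close>

definition exponents :: "ereal \<Rightarrow> ereal \<Rightarrow> real set" where
  "exponents a b = {p. a < ereal p \<and> ereal p < b}"

definition Lp :: "'a measure \<Rightarrow> real \<Rightarrow> ('a \<Rightarrow> real) set" where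
  "Lp M p = {f \<in> borel_measurable M. integrable M (\<lambda>x. \<bar>f x\<bar> powr p)}"

text \<open>To be used for functions in \<open>Lp M p\<close> only: the integral is a Bochner integral.\<close>

definition Lp_norm :: "'a measure \<Rightarrow> real \<Rightarrow> ('a \<Rightarrow> real) \<Rightarrow> real" where
  "Lp_norm M p f = (\<integral>x. \<bar>f x\<bar> powr p \<partial>M) powr (1 / p)"

definition equimeasurable :: "'a measure \<Rightarrow> ('a \<Rightarrow> real) \<Rightarrow> ('a \<Rightarrow> real) \<Rightarrow> bool" where
  "equimeasurable M f g \<longleftrightarrow>
     (\<forall>l\<ge>0. emeasure M {x \<in> space M. \<bar>f x\<bar> > l} = emeasure M {x \<in> space M. \<bar>g x\<bar> > l})"

text \<open>
  Norms are extended valued: they are given on all measurable functions and may be infinite.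
  Monotonicity is stated pointwise; together with rearrangement invariance it yields monotonicity
  with respect to the almost everywhere order.
\<close>

definition ri_norm :: "'a measure \<Rightarrow> (('a \<Rightarrow> real) \<Rightarrow> ennreal) \<Rightarrow> bool" where
  "ri_norm M N \<longleftrightarrow>
     (\<forall>f\<in>borel_measurable M. N f = 0 \<longleftrightarrow> (AE x in M. f x = 0)) \<and>
     (\<forall>f\<in>borel_measurable M. \<forall>r::real. N (\<lambda>x. r * f x) = ennreal \<bar>r\<bar> * N f) \<and>
     (\<forall>f\<in>borel_measurable M. \<forall>g\<in>borel_measurable M. N (\<lambda>x. f x + g x) \<le> N f + N g) \<and>
     (\<forall>f\<in>borel_measurable M. \<forall>g\<in>borel_measurable M.
        (\<forall>x\<in>space M. \<bar>f x\<bar> \<le> \<bar>g x\<bar>) \<longrightarrow> N f \<le> N g) \<and>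
     (\<forall>f\<in>borel_measurable M. \<forall>g\<in>borel_measurable M. equimeasurable M f g \<longrightarrow> N f = N g)"

text \<open>
  A rearrangement invariant function space in the sense of Bennett and Sharpley, represented by
  its norm, which takes the value \<open>\<infinity>\<close> outside the space. The three further conditions are the
  Fatou property, finiteness on indicators of sets of finite measure, and local integrability.
\<close>

definition ri_space :: "'a measure \<Rightarrow> (('a \<Rightarrow> real) \<Rightarrow> ennreal) \<Rightarrow> bool" where
  "ri_space M N \<longleftrightarrow>
     ri_norm M N \<and>
     (\<forall>F. \<forall>f\<in>borel_measurable M.
        (\<forall>k. F k \<in> borel_measurable M) \<and>
        (\<forall>x\<in>space M. (\<forall>k. 0 \<le> F k x) \<and> incseq (\<lambda>k. F k x) \<and> (\<lambda>k. F k x) \<longlonglongrightarrow> f x) \<longrightarrow>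
        N f = (SUP k. N (F k))) \<and>
     (\<forall>E\<in>sets M. emeasure M E < \<infinity> \<longrightarrow> N (indicator E) < \<infinity>) \<and>
     (\<forall>E\<in>sets M. emeasure M E < \<infinity> \<longrightarrow>
        (\<exists>C>0. \<forall>f\<in>borel_measurable M. (\<integral>\<^sup>+x\<in>E. ennreal \<bar>f x\<bar> \<partial>M) \<le> ennreal C * N f))"

definition space_of :: "'a measure \<Rightarrow> (('a \<Rightarrow> real) \<Rightarrow> ennreal) \<Rightarrow> ('a \<Rightarrow> real) set" where
  "space_of M N = {f \<in> borel_measurable M. N f < \<infinity>}"

definition fundamental_function :: "'a measure \<Rightarrow> (('a \<Rightarrow> real) \<Rightarrow> ennreal) \<Rightarrow> real \<Rightarrow> ennreal" where
  "fundamental_function M N \<delta> =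
     (SUP E\<in>{E \<in> sets M. emeasure M E \<le> ennreal \<delta>}. N (indicator E))"

text \<open>
  Moment rearrangement invariant space with moment support \<open>(a, b)\<close> and auxiliary norm \<open>aux\<close>.
  The auxiliary norm is rearrangement invariant with respect to the measure \<open>\<nu>\<close> on the Borel sets
  of \<open>(a, b)\<close>, for instance Lebesgue measure. As it acts on real functions, the moments of
  the elements of the space are required to be finite.
\<close>

definition mri_space ::
  "'a measure \<Rightarrow> (('a \<Rightarrow> real) \<Rightarrow> ennreal) \<Rightarrow> ereal \<Rightarrow> ereal \<Rightarrow>
     real measure \<Rightarrow> ((real \<Rightarrow> real) \<Rightarrow> ennreal) \<Rightarrow> bool" where
  "mri_space M N a b \<nu> aux \<longleftrightarrow>
     ri_space M N \<and>
     1 \<le> a \<and> a < b \<and>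
     space \<nu> = exponents a b \<and> sets \<nu> = sets (restrict_space borel (exponents a b)) \<and>
     ri_norm \<nu> aux \<and>
     (\<forall>f\<in>space_of M N. (\<forall>p\<in>exponents a b. f \<in> Lp M p) \<and> N f = aux (\<lambda>p. Lp_norm M p f))"

definition interval_above :: "ereal \<Rightarrow> ereal \<Rightarrow> ereal \<Rightarrow> ereal \<Rightarrow> bool" where
  "interval_above c d a b \<longleftrightarrow> min c d > max a b"

definition linear_subspace :: "('a \<Rightarrow> real) set \<Rightarrow> bool" where
  "linear_subspace S \<longleftrightarrow>
     (\<lambda>x. 0) \<in> S \<and>
     (\<forall>f\<in>S. \<forall>g\<in>S. (\<lambda>x. f x + g x) \<in> S) \<and>
     (\<forall>f\<in>S. \<forall>r. (\<lambda>x. r * f x) \<in> S)"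

definition nikolskii_class ::
  "'a measure \<Rightarrow> (nat \<Rightarrow> ('a \<Rightarrow> real) set) \<Rightarrow> (nat \<Rightarrow> real) \<Rightarrow>
     ereal \<Rightarrow> ereal \<Rightarrow> ereal \<Rightarrow> ereal \<Rightarrow> bool" where
  "nikolskii_class M A \<sigma> p1 p2 q1 q2 \<longleftrightarrow>
     1 \<le> p1 \<and> p1 < p2 \<and> p2 < q1 \<and> q1 < q2 \<and>
     mono \<sigma> \<and> (\<forall>n. 3 \<le> \<sigma> n) \<and> filterlim \<sigma> at_top sequentially \<and>
     (\<forall>n. linear_subspace (A n) \<and> A n \<subseteq> (\<Inter>p\<in>exponents p1 q2. Lp M p)) \<and>
     (\<forall>n m. n < m \<longrightarrow> A n \<subseteq> A m) \<and>
     (\<exists>C::real. \<forall>p\<in>exponents p1 p2. \<forall>q\<in>exponents q1 q2. \<forall>n. \<forall>t\<in>A n.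
        Lp_norm M q t \<le> C * \<sigma> n powr (1 / p - 1 / q) * Lp_norm M p t)"

text \<open>
  Here \<open>t \<noteq> 0\<close> is understood almost everywhere. The quotients are taken in \<^typ>\<open>ennreal\<close>.
  If the fundamental functions are positive and finite at the points in question, then a function
  outside \<open>Y\<close> contributes \<open>0\<close>, and a function in \<open>Y\<close> but not in \<open>X\<close> contributes \<open>\<infinity>\<close>.
  If both fundamental functions vanish, because \<open>M\<close> has no sets of small positive measure, then the
  quotient is undefined and takes the value \<open>0\<close> by the convention \<open>\<infinity> / \<infinity> = 0\<close>.
\<close>

definition nikolskii_W ::
  "'a measure \<Rightarrow> (nat \<Rightarrow> ('a \<Rightarrow> real) set) \<Rightarrow> (nat \<Rightarrow> real) \<Rightarrow>
     (('a \<Rightarrow> real) \<Rightarrow> ennreal) \<Rightarrow> (('a \<Rightarrow> real) \<Rightarrow> ennreal) \<Rightarrow> real \<Rightarrow> real \<Rightarrow> nat \<Rightarrow> ennreal" where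
  "nikolskii_W M A \<sigma> X Y K1 K2 n =
     (SUP t\<in>{t \<in> A n. \<not> (AE x in M. t x = 0)}.
        (X t / fundamental_function M X (K1 / \<sigma> n)) / (Y t / fundamental_function M Y (K2 / \<sigma> n)))"

definition nikolskii_pair ::
  "'a measure \<Rightarrow> (nat \<Rightarrow> ('a \<Rightarrow> real) set) \<Rightarrow> (nat \<Rightarrow> real) \<Rightarrow>
     (('a \<Rightarrow> real) \<Rightarrow> ennreal) \<Rightarrow> (('a \<Rightarrow> real) \<Rightarrow> ennreal) \<Rightarrow> bool" where
  "nikolskii_pair M A \<sigma> X Y \<longleftrightarrow> (SUP n. nikolskii_W M A \<sigma> X Y 1 1 n) < \<infinity>"

end

theory Submission
  imports Defs
begin

text \<open>
  Put \<open>u = 1 / \<sigma> n\<close>. The Nikol'skii inequality says that for \<open>t \<in> A n\<close> a single number \<open>K\<close>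
  satisfies \<open>\<bar>t\<bar>\<^sub>q \<le> K u\<^bsup>1/q\<^esup>\<close> and \<open>K u\<^bsup>1/p\<^esup> \<le> C \<bar>t\<bar>\<^sub>p\<close> for all admissible \<open>p\<close>, \<open>q\<close>. Applying the
  auxiliary norms bounds \<open>X t\<close> from above and \<open>Y t\<close> from below by multiples of the norms of
  \<open>q \<mapsto> u\<^bsup>1/q\<^esup>\<close> and \<open>p \<mapsto> u\<^bsup>1/p\<^esup>\<close>. If there are sets of measure \<open>u\<close>, these norms are the fundamental
  functions. In general a set of measure \<open>s \<le> u\<close> costs a factor \<open>(s/u)\<^bsup>1/r\<^esup>\<close> on both sides, with any
  fixed \<open>r\<close> between the two ranges of exponents, and the two factors cancel.
\<close>

section \<open>Consequences of the norm axioms\<close>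

lemma ri_norm_eq_0_iff:
  assumes "ri_norm M N" "f \<in> borel_measurable M"
  shows "N f = 0 \<longleftrightarrow> (AE x in M. f x = 0)"
  using assms unfolding ri_norm_def by blast

lemma ri_norm_scale:
  assumes "ri_norm M N" "f \<in> borel_measurable M"
  shows "N (\<lambda>x. r * f x) = ennreal \<bar>r\<bar> * N f"
  using assms unfolding ri_norm_def by blast

lemma ri_norm_mono:
  assumes "ri_norm M N" "f \<in> borel_measurable M" "g \<in> borel_measurable M"
    and "\<And>x. x \<in> space M \<Longrightarrow> \<bar>f x\<bar> \<le> \<bar>g x\<bar>"
  shows "N f \<le> N g"
  using assms unfolding ri_norm_def by blast

lemma ri_space_fatou:
  assumes "ri_space M N" "f \<in> borel_measurable M" "\<And>k. F k \<in> borel_measurable M"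
    and "\<And>k x. x \<in> space M \<Longrightarrow> 0 \<le> F k x"
    and "\<And>x. x \<in> space M \<Longrightarrow> incseq (\<lambda>k. F k x)"
    and "\<And>x. x \<in> space M \<Longrightarrow> (\<lambda>k. F k x) \<longlonglongrightarrow> f x"
  shows "N f = (SUP k. N (F k))"
  using assms unfolding ri_space_def by blast

lemma ri_space_indicator_finite:
  assumes "ri_space M N" "E \<in> sets M" "emeasure M E < \<infinity>"
  shows "N (indicator E) < \<infinity>"
  using assms unfolding ri_space_def by blast

section \<open>Moments as functions of the exponent\<close>

lemma Lp_norm_nonneg: "0 \<le> Lp_norm M p f"
  by (simp add: Lp_norm_def)

lemma Lp_norm_mono:
  assumes "0 < p" "f \<in> Lp M p" "g \<in> Lp M p"
    and "\<And>x. x \<in> space M \<Longrightarrow> \<bar>f x\<bar> \<le> \<bar>g x\<bar>"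
  shows "Lp_norm M p f \<le> Lp_norm M p g"
  using assms unfolding Lp_norm_def Lp_def
  by (auto intro!: powr_mono2 integral_mono)

lemma Lp_norm_indicator:
  assumes "E \<in> sets M"
  shows "Lp_norm M p (indicator E) = measure M E powr (1 / p)"
proof -
  have "(\<lambda>x. \<bar>indicator E x :: real\<bar> powr p) = indicator E"
    by (auto simp: indicator_def)
  then show ?thesis
    using assms by (simp add: Lp_norm_def)
qed

text \<open>The axioms for auxiliary norms speak of measurable functions only, so moment functions
  must be measurable in the exponent. This is measurability of a parametrised integral, which rests
  on \<sigma>-finiteness.\<close>

lemma Lp_norm_measurable:
  assumes "sigma_finite_measure M" "f \<in> borel_measurable M"
    and "sets \<nu> = sets (restrict_space borel S)"
  shows "(\<lambda>p. Lp_norm M p f) \<in> borel_measurable \<nu>"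
proof -
  interpret sigma_finite_measure M by fact
  note assms(2)[measurable]
  have [measurable]: "(\<lambda>p. p) \<in> borel_measurable \<nu>"
    by (subst measurable_cong_sets[OF assms(3) refl]) (simp add: measurable_restrict_space1)
  show ?thesis
    unfolding Lp_norm_def by measurable
qed

section \<open>Moment spaces and their auxiliary norms\<close>

lemma mri_space_exponent_pos:
  assumes "mri_space M N a b \<nu> aux" "p \<in> exponents a b"
  shows "1 < p"
proof -
  have "1 \<le> a" "a < ereal p"
    using assms by (auto simp: mri_space_def exponents_def)
  then have "1 < ereal p"
    by (rule le_less_trans)
  then show ?thesis by simp
qed

lemma mri_space_powr_measurable:
  assumes "mri_space M N a b \<nu> aux"
  shows "(\<lambda>p. s powr (1 / p)) \<in> borel_measurable \<nu>"
proof -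
  have "sets \<nu> = sets (restrict_space borel (exponents a b))"
    using assms by (simp add: mri_space_def)
  then have [measurable]: "(\<lambda>p. p) \<in> borel_measurable \<nu>"
    by (subst measurable_cong_sets[OF _ refl]) (auto simp: measurable_restrict_space1)
  show ?thesis by measurable
qed

lemma mri_space_indicator:
  assumes "mri_space M N a b \<nu> aux" "E \<in> sets M" "emeasure M E < \<infinity>"
  shows "N (indicator E) = aux (\<lambda>p. measure M E powr (1 / p))"
proof -
  have "N (indicator E) < \<infinity>"
    using assms ri_space_indicator_finite by (auto simp: mri_space_def)
  then have "indicator E \<in> space_of M N"
    using assms(2) by (simp add: space_of_def)
  then show ?thesis
    using assms(1,2) by (simp add: mri_space_def Lp_norm_indicator)
qed

text \<open>
  The defining identity of a moment space is available only where the norm is finite.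
  By the Fatou property, finite moments still bound the norm in general.
\<close>

lemma mri_space_le_aux:
  assumes M: "sigma_finite_measure M" and N: "mri_space M N a b \<nu> aux"
    and f: "f \<in> borel_measurable M" and fp: "\<And>p. p \<in> exponents a b \<Longrightarrow> f \<in> Lp M p"
    and h: "h \<in> borel_measurable \<nu>" and le: "\<And>p. p \<in> exponents a b \<Longrightarrow> Lp_norm M p f \<le> h p"
  shows "N f \<le> aux h"
proof -
  note f[measurable]
  have ri: "ri_space M N" "ri_norm M N" "ri_norm \<nu> aux" "space \<nu> = exponents a b"
    and sets: "sets \<nu> = sets (restrict_space borel (exponents a b))"
    using N by (auto simp: mri_space_def ri_space_def)
  interpret sigma_finite_measure M by fact
  obtain S :: "nat \<Rightarrow> 'a set" where S: "range S \<subseteq> sets M" "(\<Union>i. S i) = space M"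
    "\<And>i. emeasure M (S i) \<noteq> \<infinity>" "incseq S"
    using sigma_finite_incseq by metis
  have S_sets[measurable]: "S k \<in> sets M" for k
    using S(1) by auto
  \<comment> \<open>Truncating both the height and the support puts \<open>F k\<close> below a
    multiple of the indicator of a set of finite measure. Hence \<open>N (F k)\<close> is finite and
    the defining identity applies to \<open>F k\<close>, while \<open>F k\<close> increases to
    \<bar>f\<bar>.\<close>
  define F where "F k x = min \<bar>f x\<bar> (real k) * indicator (S k) x" for k x
  have F_meas[measurable]: "F k \<in> borel_measurable M" for k
    unfolding F_def by measurable
  have F_le: "0 \<le> F k x" "F k x \<le> \<bar>f x\<bar>" "F k x \<le> real k * indicator (S k) x" for k x
    by (auto simp: F_def indicator_def)
  have inc: "incseq (\<lambda>k. F k x)" for x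
  proof (rule incseq_SucI)
    fix k
    have "S k \<subseteq> S (Suc k)"
      using S(4) by (simp add: incseq_SucD)
    then show "F k x \<le> F (Suc k) x"
      by (auto simp: F_def indicator_def)
  qed
  have lim: "(\<lambda>k. F k x) \<longlonglongrightarrow> \<bar>f x\<bar>" if x: "x \<in> space M" for x
  proof (rule tendsto_eventually)
    obtain i where i: "x \<in> S i"
      using x S(2) by blast
    have "F k x = \<bar>f x\<bar>" if k: "k \<ge> max i (nat \<lceil>\<bar>f x\<bar>\<rceil>)" for k
    proof -
      have "x \<in> S k"
        using k i incseqD[OF S(4), of i k] by auto
      moreover have "\<bar>f x\<bar> \<le> real k"
        using k by (simp add: nat_ceiling_le_eq)
      ultimately show ?thesis
        by (simp add: F_def)
    qed
    then show "\<forall>\<^sub>F k in sequentially. F k x = \<bar>f x\<bar>"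
      using eventually_sequentially by blast
  qed
  have "N f \<le> N (\<lambda>x. \<bar>f x\<bar>)"
    by (rule ri_norm_mono[OF ri(2)]) auto
  also have "\<dots> = (SUP k. N (F k))"
    by (rule ri_space_fatou[OF ri(1)]) (auto simp: F_le inc lim)
  also have "\<dots> \<le> aux h"
  proof (rule SUP_least)
    fix k
    have "N (F k) \<le> N (\<lambda>x. real k * indicator (S k) x)"
      using F_le by (intro ri_norm_mono[OF ri(2)]) auto
    also have "\<dots> = ennreal \<bar>real k\<bar> * N (indicator (S k))"
      by (rule ri_norm_scale[OF ri(2)]) auto
    also have "\<dots> < \<infinity>"
      using ri_space_indicator_finite[OF ri(1) S_sets] S(3)
      by (auto simp: ennreal_mult_less_top less_top)
    finally have "F k \<in> space_of M N"
      by (simp add: space_of_def)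
    then have Fp: "\<And>p. p \<in> exponents a b \<Longrightarrow> F k \<in> Lp M p"
      and eq: "N (F k) = aux (\<lambda>p. Lp_norm M p (F k))"
      using N by (auto simp: mri_space_def)
    have "Lp_norm M p (F k) \<le> h p" if p: "p \<in> exponents a b" for p
    proof -
      have "Lp_norm M p (F k) \<le> Lp_norm M p f"
        using F_le mri_space_exponent_pos[OF N p] by (intro Lp_norm_mono Fp fp p) auto
      then show ?thesis
        using le[OF p] by simp
    qed
    moreover have "\<bar>h p\<bar> = h p" if "p \<in> exponents a b" for p
      using le[OF that] Lp_norm_nonneg[of M p f] by simp
    ultimately show "N (F k) \<le> aux h"
      unfolding eq using h ri(4)
      by (intro ri_norm_mono[OF ri(3)] Lp_norm_measurable[OF M F_meas sets])
        (auto simp: Lp_norm_nonneg)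
  qed
  finally show ?thesis .
qed

text \<open>There may be no set of measure \<open>u\<close>, so the function is compared with the
  moments of some set of positive finite measure, whose indicator has finite norm.\<close>

lemma mri_space_aux_powr_finite:
  assumes M: "sigma_finite_measure M" "emeasure M (space M) \<noteq> 0"
    and N: "mri_space M N a b \<nu> aux" and u: "0 < u"
  shows "aux (\<lambda>p. u powr (1 / p)) < \<infinity>"
proof -
  have ri: "ri_space M N" "ri_norm \<nu> aux" "space \<nu> = exponents a b"
    using N by (auto simp: mri_space_def)
  interpret sigma_finite_measure M by fact
  obtain S :: "nat \<Rightarrow> 'a set" where S: "range S \<subseteq> sets M" "(\<Union>i. S i) = space M"
    "\<And>i. emeasure M (S i) \<noteq> \<infinity>"
    using sigma_finite by metis
  obtain i where i: "emeasure M (S i) \<noteq> 0"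
    using M(2) S emeasure_UN_eq_0[of M S] by metis
  define s where "s = measure M (S i)"
  have E: "S i \<in> sets M" "emeasure M (S i) < \<infinity>"
    using S by (auto simp: less_top)
  have s: "0 < s"
    using i S(3)[of i] by (auto simp: s_def measure_def enn2real_positive_iff less_top zero_less_iff_neq_zero)
  \<comment> \<open>With \<open>c\<close> at least 1, \<open>c powr (1 / p)\<close> is at most
    \<open>c\<close> for every exponent above 1, so one constant serves the whole range.\<close>
  define c where "c = max 1 (u / s)"
  have c: "1 \<le> c" "u \<le> c * s"
    using s by (auto simp: c_def field_simps max_def)
  have "u powr (1 / p) \<le> c * s powr (1 / p)" if p: "p \<in> exponents a b" for p
  proof -
    have p1: "1 < p"
      by (rule mri_space_exponent_pos[OF N p])
    have "u powr (1 / p) \<le> (c * s) powr (1 / p)"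
      using c u p1 by (intro powr_mono2) auto
    also have "\<dots> = c powr (1 / p) * s powr (1 / p)"
      using c s by (simp add: powr_mult)
    also have "\<dots> \<le> c powr 1 * s powr (1 / p)"
      using c p1 by (intro mult_right_mono powr_mono) auto
    finally show ?thesis
      using c by simp
  qed
  then have "aux (\<lambda>p. u powr (1 / p)) \<le> aux (\<lambda>p. c * s powr (1 / p))"
    using mri_space_powr_measurable[OF N] ri(3) c
    by (intro ri_norm_mono[OF ri(2)] borel_measurable_times) (auto simp: abs_mult)
  also have "\<dots> = ennreal \<bar>c\<bar> * N (indicator (S i))"
    unfolding mri_space_indicator[OF N E] s_def
    by (intro ri_norm_scale[OF ri(2)] mri_space_powr_measurable[OF N])
  also have "\<dots> < \<infinity>"
    using ri_space_indicator_finite[OF ri(1) E] by (auto simp: ennreal_mult_less_top)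
  finally show ?thesis .
qed

section \<open>Indicators and fundamental functions\<close>

lemma mri_space_indicator_le:
  assumes N: "mri_space M N a b \<nu> aux" and E: "E \<in> sets M" "emeasure M E \<le> ennreal u"
    and u: "0 < u" and r: "0 < r" "\<And>p. p \<in> exponents a b \<Longrightarrow> p \<le> r"
  shows "N (indicator E) \<le> ennreal ((measure M E / u) powr (1 / r)) * aux (\<lambda>p. u powr (1 / p))"
proof -
  have ri: "ri_norm \<nu> aux" "space \<nu> = exponents a b"
    using N by (auto simp: mri_space_def)
  have fin: "emeasure M E < \<infinity>"
    using E(2) by (simp add: le_less_trans)
  let ?s = "measure M E"
  have s: "?s \<le> u"
    using E(2) u by (simp add: measure_def enn2real_leI)
  have "?s powr (1 / p) \<le> (?s / u) powr (1 / r) * u powr (1 / p)" if p: "p \<in> exponents a b" for p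
  proof -
    have p1: "1 < p" "p \<le> r"
      using mri_space_exponent_pos[OF N p] r(2)[OF p] by auto
    have "?s powr (1 / p) = (?s / u) powr (1 / p) * u powr (1 / p)"
      using u by (simp add: powr_divide)
    \<comment> \<open>The base \<open>?s / u\<close> is at most 1, so lowering the exponent from
      \<open>1 / p\<close> to \<open>1 / r\<close> increases the power.\<close>
    also have "\<dots> \<le> (?s / u) powr (1 / r) * u powr (1 / p)"
      using s u p1 by (intro mult_right_mono powr_mono') (auto simp: frac_le)
    finally show ?thesis .
  qed
  then have "N (indicator E) \<le> aux (\<lambda>p. (?s / u) powr (1 / r) * u powr (1 / p))"
    unfolding mri_space_indicator[OF N E(1) fin]
    using mri_space_powr_measurable[OF N] ri(2)
    by (intro ri_norm_mono[OF ri(1)] borel_measurable_times) (auto simp: abs_mult)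
  also have "\<dots> = ennreal ((?s / u) powr (1 / r)) * aux (\<lambda>p. u powr (1 / p))"
    using ri_norm_scale[OF ri(1) mri_space_powr_measurable[OF N]] by simp
  finally show ?thesis .
qed

text \<open>Mirror image of \<open>mri_space_indicator_le\<close>: for exponents above
  \<open>r\<close> the same factor bounds from below, so it can be exchanged between a space below
  \<open>r\<close> and a space above it.\<close>

lemma mri_space_indicator_ge:
  assumes N: "mri_space M N a b \<nu> aux" and E: "E \<in> sets M" "emeasure M E \<le> ennreal u"
    and u: "0 < u" and r: "0 < r" "\<And>p. p \<in> exponents a b \<Longrightarrow> r \<le> p"
  shows "ennreal ((measure M E / u) powr (1 / r)) * aux (\<lambda>p. u powr (1 / p)) \<le> N (indicator E)"
proof -
  have ri: "ri_norm \<nu> aux" "space \<nu> = exponents a b"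
    using N by (auto simp: mri_space_def)
  have fin: "emeasure M E < \<infinity>"
    using E(2) by (simp add: le_less_trans)
  let ?s = "measure M E"
  have s: "?s \<le> u"
    using E(2) u by (simp add: measure_def enn2real_leI)
  have le: "(?s / u) powr (1 / r) * u powr (1 / p) \<le> ?s powr (1 / p)" if p: "p \<in> exponents a b" for p
  proof -
    have "(?s / u) powr (1 / r) * u powr (1 / p) \<le> (?s / u) powr (1 / p) * u powr (1 / p)"
      using s u r(1) r(2)[OF p] by (intro mult_right_mono powr_mono') (auto simp: frac_le)
    also have "\<dots> = ?s powr (1 / p)"
      using u by (simp add: powr_divide)
    finally show ?thesis .
  qed
  have "ennreal ((?s / u) powr (1 / r)) * aux (\<lambda>p. u powr (1 / p))
      = aux (\<lambda>p. (?s / u) powr (1 / r) * u powr (1 / p))"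
    using ri_norm_scale[OF ri(1) mri_space_powr_measurable[OF N]] by simp
  also have "\<dots> \<le> N (indicator E)"
    unfolding mri_space_indicator[OF N E(1) fin]
    using mri_space_powr_measurable[OF N] ri(2) le
    by (intro ri_norm_mono[OF ri(1)] borel_measurable_times) (auto simp: abs_mult)
  finally show ?thesis .
qed

lemma fundamental_function_le_aux:
  assumes N: "mri_space M N a b \<nu> aux"
    and u: "0 < u" and r: "0 < r" "\<And>p. p \<in> exponents a b \<Longrightarrow> p \<le> r"
  shows "fundamental_function M N u \<le> aux (\<lambda>p. u powr (1 / p))"
  unfolding fundamental_function_def
proof (rule SUP_least)
  fix E assume "E \<in> {E \<in> sets M. emeasure M E \<le> ennreal u}"
  then have E: "E \<in> sets M" "emeasure M E \<le> ennreal u" by auto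
  have "measure M E \<le> u"
    using E(2) u by (simp add: measure_def enn2real_leI)
  then have "(measure M E / u) powr (1 / r) \<le> 1"
    using u r(1) by (intro powr_le1) auto
  then have "ennreal ((measure M E / u) powr (1 / r)) * aux (\<lambda>p. u powr (1 / p))
      \<le> 1 * aux (\<lambda>p. u powr (1 / p))"
    by (intro mult_right_mono) (auto simp: ennreal_le_1)
  then show "N (indicator E) \<le> aux (\<lambda>p. u powr (1 / p))"
    using mri_space_indicator_le[OF N E u r] by simp
qed

text \<open>For each set \<open>E\<close> the factor lost on the \<open>Y\<close> side is the one
  needed on the \<open>X\<close> side, and it is moved across before taking suprema. The product
  form stays meaningful when both fundamental functions vanish.\<close>

lemma fundamental_function_mult_le:
  assumes X: "mri_space M X c d \<nu>\<^sub>X aux\<^sub>X" and Y: "mri_space M Y a b \<nu>\<^sub>Y aux\<^sub>Y"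
    and u: "0 < u" and r: "0 < r"
    and "\<And>p. p \<in> exponents a b \<Longrightarrow> p \<le> r" "\<And>q. q \<in> exponents c d \<Longrightarrow> r \<le> q"
  shows "aux\<^sub>X (\<lambda>q. u powr (1 / q)) * fundamental_function M Y u
    \<le> fundamental_function M X u * aux\<^sub>Y (\<lambda>p. u powr (1 / p))"
proof -
  have "aux\<^sub>X (\<lambda>q. u powr (1 / q)) * Y (indicator E)
      \<le> fundamental_function M X u * aux\<^sub>Y (\<lambda>p. u powr (1 / p))"
    if E: "E \<in> sets M" "emeasure M E \<le> ennreal u" for E
  proof -
    let ?w = "ennreal ((measure M E / u) powr (1 / r))"
    have "aux\<^sub>X (\<lambda>q. u powr (1 / q)) * Y (indicator E)
        \<le> aux\<^sub>X (\<lambda>q. u powr (1 / q)) * (?w * aux\<^sub>Y (\<lambda>p. u powr (1 / p)))"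
      using assms E by (intro mult_left_mono mri_space_indicator_le) auto
    also have "\<dots> = ?w * aux\<^sub>X (\<lambda>q. u powr (1 / q)) * aux\<^sub>Y (\<lambda>p. u powr (1 / p))"
      by (simp add: mult_ac)
    also have "\<dots> \<le> X (indicator E) * aux\<^sub>Y (\<lambda>p. u powr (1 / p))"
      using assms E by (intro mult_right_mono mri_space_indicator_ge) auto
    also have "\<dots> \<le> fundamental_function M X u * aux\<^sub>Y (\<lambda>p. u powr (1 / p))"
      unfolding fundamental_function_def using E by (intro mult_right_mono SUP_upper) auto
    finally show ?thesis .
  qed
  then show ?thesis
    unfolding fundamental_function_def[of M Y] by (auto simp: SUP_mult_left_ennreal intro!: SUP_least)
qed

text \<open>Passes from a cross-multiplied inequality to the quotient in \<open>nikolskii_W\<close>.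
  In the degenerate cases the conventions for 0 and \<infinity> make the quotient 0; this also
  covers functions outside \<open>Y\<close>, where \<open>y\<close> is infinite.\<close>

lemma ennreal_divide_divide_le:
  fixes x y p q c :: ennreal
  assumes le: "y < \<infinity> \<Longrightarrow> x * p \<le> c * (q * y)" and "p < \<infinity>" "y \<noteq> 0"
  shows "x / q / (y / p) \<le> c"
proof (cases "p = 0 \<or> y = \<infinity> \<or> q = \<infinity> \<or> x = 0")
  case True
  then show ?thesis
    using assms by (auto simp: ennreal_divide_top ennreal_top_divide less_top)
next
  case False
  then have le: "x * p \<le> c * (q * y)" and q: "q \<noteq> 0"
    using le by (auto simp: less_top)
  have "x / q / (y / p) = x * p / (q * y)"
    using False q assms
    by (cases x; cases y; cases p; cases q)
      (auto simp: divide_ennreal ennreal_mult[symmetric] ennreal_top_divide ennreal_top_mult less_top)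
  also have "\<dots> \<le> c"
    using le False q assms by (intro divide_le_posI_ennreal) (auto simp: mult_ac zero_less_iff_neq_zero)
  finally show ?thesis .
qed

theorem theorem1:
  fixes M :: "'a measure"
    and A :: "nat \<Rightarrow> ('a \<Rightarrow> real) set"
    and \<sigma> :: "nat \<Rightarrow> real"
    and X Y :: "('a \<Rightarrow> real) \<Rightarrow> ennreal"
    and aux_X aux_Y :: "(real \<Rightarrow> real) \<Rightarrow> ennreal"
    and \<nu>_X \<nu>_Y :: "real measure"
    and a b c d p_minus p_plus q_minus q_plus :: ereal
  assumes "sigma_finite_measure M"
    and "emeasure M (space M) \<noteq> 0"
    and "nikolskii_class M A \<sigma> p_minus p_plus q_minus q_plus"
    and "mri_space M X c d \<nu>_X aux_X"
    and "mri_space M Y a b \<nu>_Y aux_Y"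
    and "interval_above c d a b"
    and "1 \<le> p_minus" and "p_minus = a" and "p_plus = b"
    and "q_minus = c" and "q_plus = d" and "d \<le> \<infinity>"
  shows "nikolskii_pair M A \<sigma> X Y"
proof -
  note M = assms(1,2) and X = assms(4) and Y = assms(5)
  have ri: "ri_norm \<nu>_X aux_X" "space \<nu>_X = exponents c d"
      "ri_norm M Y" "ri_norm \<nu>_Y aux_Y" "space \<nu>_Y = exponents a b"
    and sets: "sets \<nu>_Y = sets (restrict_space borel (exponents a b))"
    using X Y by (auto simp: mri_space_def ri_space_def)
  have ord: "1 \<le> a" "a < b" "b < c" "c < d" and \<sigma>: "\<And>n. 3 \<le> \<sigma> n"
    and A: "\<And>n. A n \<subseteq> (\<Inter>p\<in>exponents a d. Lp M p)"
    using assms(3,8-11) by (auto simp: nikolskii_class_def)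
  obtain C0 where C0: "\<And>p q n t. p \<in> exponents a b \<Longrightarrow> q \<in> exponents c d \<Longrightarrow> t \<in> A n \<Longrightarrow>
      Lp_norm M q t \<le> C0 * \<sigma> n powr (1 / p - 1 / q) * Lp_norm M p t"
    using assms(3,8-11) unfolding nikolskii_class_def by metis
  \<comment> \<open>The sign of \<open>C0\<close> is not prescribed; the absolute value makes the
    constant safe to embed in \<open>ennreal\<close>.\<close>
  define C where "C = \<bar>C0\<bar>"
  obtain p0 q0 where p0: "p0 \<in> exponents a b" and q0: "q0 \<in> exponents c d"
    using ereal_dense2[OF ord(2)] ereal_dense2[OF ord(4)] by (auto simp: exponents_def)
  \<comment> \<open>The separating exponent comes from the gap between the two ranges.\<close>
  obtain r where r: "b < ereal r" "ereal r < c"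
    using ereal_dense2[OF ord(3)] by blast
  have r_ge: "p \<le> r" if "p \<in> exponents a b" for p
    using that r less_trans[of "ereal p" b "ereal r"] by (auto simp: exponents_def)
  have r_le: "r \<le> q" if "q \<in> exponents c d" for q
    using that r less_trans[of "ereal r" c "ereal q"] by (auto simp: exponents_def)
  have r_pos: "0 < r"
    using r_ge[OF p0] mri_space_exponent_pos[OF Y p0] by simp
  \<comment> \<open>The absolute value of the Nikol'skii constant itself is the uniform
    bound.\<close>
  have "nikolskii_W M A \<sigma> X Y 1 1 n \<le> ennreal C" for n
    unfolding nikolskii_W_def
  proof (rule SUP_least, rule ennreal_divide_divide_le)
    fix t assume "t \<in> {t \<in> A n. \<not> (AE x in M. t x = 0)}"
    then have t: "t \<in> A n" "\<not> (AE x in M. t x = 0)" by auto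
    define u where "u = 1 / \<sigma> n"
    have u: "0 < u" "\<sigma> n = 1 / u"
      using \<sigma>[of n] by (auto simp: u_def)
    have sub: "exponents c d \<subseteq> exponents a d"
      using ord by (auto simp: exponents_def intro: less_trans)
    have tq: "t \<in> Lp M q" if "q \<in> exponents c d" for q
      using A[of n] t(1) that sub by auto
    have tm: "t \<in> borel_measurable M"
      using tq[OF q0] by (simp add: Lp_def)
    show Y0: "Y t \<noteq> 0"
      using ri_norm_eq_0_iff[OF ri(3) tm] t(2) by simp
    show "fundamental_function M Y (1 / \<sigma> n) < \<infinity>"
      using fundamental_function_le_aux[OF Y u(1) r_pos r_ge]
        mri_space_aux_powr_finite[OF M Y u(1)] by (auto simp: u_def le_less_trans)
    define k where "k q = Lp_norm M q t / u powr (1 / q)" for q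
    \<comment> \<open>The Nikol'skii inequality bounds \<open>k q\<close> by a quantity depending on
      \<open>p\<close> alone. The supremum over \<open>q\<close> is therefore finite, obeys the same
      bound for every \<open>p\<close>, and so decouples the two ranges.\<close>
    define K where "K = (SUP q\<in>exponents c d. k q)"
    have k_le: "k q \<le> C * Lp_norm M p t / u powr (1 / p)"
      if "p \<in> exponents a b" "q \<in> exponents c d" for p q
    proof -
      have "Lp_norm M q t \<le> C0 * \<sigma> n powr (1 / p - 1 / q) * Lp_norm M p t"
        by (rule C0[OF that t(1)])
      also have "\<dots> \<le> C * \<sigma> n powr (1 / p - 1 / q) * Lp_norm M p t"
        by (intro mult_right_mono Lp_norm_nonneg) (auto simp: C_def)
      also have "\<sigma> n powr (1 / p - 1 / q) = u powr (1 / q) / u powr (1 / p)"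
        using u by (simp add: powr_divide powr_diff)
      finally show ?thesis
        using u(1) by (simp add: k_def field_simps)
    qed
    have bdd: "bdd_above (k ` exponents c d)"
      using k_le[OF p0] by (auto intro!: bdd_aboveI2)
    have K_ge: "Lp_norm M q t \<le> K * u powr (1 / q)" if "q \<in> exponents c d" for q
    proof -
      have "k q \<le> K"
        unfolding K_def by (rule cSUP_upper[OF that bdd])
      then show ?thesis
        using u(1) by (simp add: k_def field_simps)
    qed
    have K_le: "K * u powr (1 / p) \<le> C * Lp_norm M p t" if "p \<in> exponents a b" for p
    proof -
      have "K \<le> C * Lp_norm M p t / u powr (1 / p)"
        unfolding K_def using q0 k_le[OF that] by (intro cSUP_least) auto
      then show ?thesis
        using u(1) by (simp add: field_simps)
    qed
    have "0 \<le> k q0" "k q0 \<le> K"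
      using cSUP_upper[OF q0 bdd] by (auto simp: k_def K_def Lp_norm_nonneg)
    then have K0: "0 \<le> K" by simp
    \<comment> \<open>Membership of \<open>t\<close> in \<open>X\<close> is not known, so the Fatou
      bound \<open>mri_space_le_aux\<close> replaces the defining identity.\<close>
    have X_le: "X t \<le> ennreal K * aux_X (\<lambda>q. u powr (1 / q))"
    proof -
      have "X t \<le> aux_X (\<lambda>q. K * u powr (1 / q))"
        using mri_space_powr_measurable[OF X]
        by (intro mri_space_le_aux[OF M(1) X tm tq _ K_ge] borel_measurable_times) auto
      also have "\<dots> = ennreal K * aux_X (\<lambda>q. u powr (1 / q))"
        using ri_norm_scale[OF ri(1) mri_space_powr_measurable[OF X]] K0 by simp
      finally show ?thesis .
    qed
    have Y_ge: "ennreal K * aux_Y (\<lambda>p. u powr (1 / p)) \<le> ennreal C * Y t"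
      if "t \<in> space_of M Y"
    proof -
      have Yt: "Y t = aux_Y (\<lambda>p. Lp_norm M p t)"
        using Y that by (auto simp: mri_space_def)
      note meas = Lp_norm_measurable[OF M(1) tm sets]
      have "ennreal K * aux_Y (\<lambda>p. u powr (1 / p)) = aux_Y (\<lambda>p. K * u powr (1 / p))"
        using ri_norm_scale[OF ri(4) mri_space_powr_measurable[OF Y]] K0 by simp
      also have "\<dots> \<le> aux_Y (\<lambda>p. C * Lp_norm M p t)"
        using mri_space_powr_measurable[OF Y] meas K_le K0 ri(5)
        by (intro ri_norm_mono[OF ri(4)] borel_measurable_times)
          (auto simp: abs_mult Lp_norm_nonneg C_def)
      also have "\<dots> = ennreal C * Y t"
        unfolding Yt using ri_norm_scale[OF ri(4) meas, of C] by (simp add: C_def)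
      finally show ?thesis .
    qed
    assume "Y t < \<infinity>"
    then have tY: "t \<in> space_of M Y"
      using tm by (simp add: space_of_def)
    \<comment> \<open>The number \<open>K\<close> enters through the bound on \<open>X t\<close> and
      leaves through the bound on \<open>Y t\<close>; in between, the auxiliary norm of
      \<open>X\<close> is traded for that of \<open>Y\<close>.\<close>
    let ?\<phi> = "\<lambda>Z. fundamental_function M Z u"
    have "X t * ?\<phi> Y \<le> ennreal K * (aux_X (\<lambda>q. u powr (1 / q)) * ?\<phi> Y)"
      using mult_right_mono[OF X_le, of "?\<phi> Y"] by (simp add: mult_ac)
    also have "\<dots> \<le> ennreal K * (?\<phi> X * aux_Y (\<lambda>p. u powr (1 / p)))"
      using fundamental_function_mult_le[OF X Y u(1) r_pos r_ge r_le] by (intro mult_left_mono) auto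
    also have "\<dots> = ?\<phi> X * (ennreal K * aux_Y (\<lambda>p. u powr (1 / p)))"
      by (simp add: mult_ac)
    also have "\<dots> \<le> ?\<phi> X * (ennreal C * Y t)"
      using Y_ge[OF tY] by (intro mult_left_mono) auto
    finally show "X t * fundamental_function M Y (1 / \<sigma> n)
        \<le> ennreal C * (fundamental_function M X (1 / \<sigma> n) * Y t)"
      by (simp add: u_def mult_ac)
  qed
  then have "(SUP n. nikolskii_W M A \<sigma> X Y 1 1 n) \<le> ennreal C"
    by (rule SUP_least)
  then show ?thesis
    unfolding nikolskii_pair_def by (simp add: le_less_trans)
qed

end
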